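(* Let $n\in\{2,3\}$, let $f:\mathbb{R}\to\mathbb{R}$ be of class $C^1$, and let a body in $\mathbb{R}^n$, which is $C^3$-smooth and convex at time $0$, evolve under the radial distance-driven flow $r_t=f(r)$, where $r(u,t)$, $u\in\mathbb{S}^{n-1}$, is its radial function with respect to the origin, and $r(\cdot,0)$ is a Morse function. If the center of mass of the body coincides with the origin for all times $t$, then the total number $T$ of static equilibrium points is constant in time. Moreover, in this case the number $S$ of stable equilibria and the number $U$ of unstable equilibria are both constant in time, and so is the number $H$ of saddles.
   Context: Radial distance-driven flow: for each fixed $u\in\mathbb{S}^{n-1}$, $t\mapsto r(u,t)>0$ solves $r_t(u,t)=f(r(u,t))$, and the boundary of the body at time $t$ is $\{r(u,t)u:u\in\mathbb{S}^{n-1}\}$; $t$ ranges over a time interval containing $0$ on which these solutions exist and are positive. Static equilibrium points of a body with center of mass at the origin are the spatial critical points of $u\mapsto r(u,t)$. Stable equilibria are local minima, unstable equilibria are local maxima, and saddles are the remaining critical points of $r(\cdot,t)$; $S$, $U$, $H$ denote their numbers and $T=S+U+H$ (with $H=0$ when $n=2$). *)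

theory Defs
  imports "HOL-Analysis.Analysis"
begin

(* Continuous differentiability of order k, meant for open W.  In finite dimension the k-th
   Frechet derivative exists and is continuous iff all iterated directional derivatives do so. *)
primrec Ck_on :: "nat \<Rightarrow> ('a::euclidean_space \<Rightarrow> real) \<Rightarrow> 'a set \<Rightarrow> bool" where
  "Ck_on 0 g W \<longleftrightarrow> continuous_on W g"
| "Ck_on (Suc k) g W \<longleftrightarrow>
     (\<forall>x\<in>W. g differentiable (at x)) \<and>
     (\<forall>v. Ck_on k (\<lambda>x. frechet_derivative g (at x) v) W)"

(* For k >= 1: near each boundary point, K is the sublevel set of a C^k function with nonzero
   differential there.  Since p is a boundary point, phi p = 0 follows. *)
definition Ck_smooth_body :: "nat \<Rightarrow> 'a::euclidean_space set \<Rightarrow> bool" where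
  "Ck_smooth_body k K \<longleftrightarrow>
     (\<forall>p\<in>frontier K. \<exists>W \<phi>. open W \<and> p \<in> W \<and> Ck_on k \<phi> W \<and>
        (\<exists>v. frechet_derivative \<phi> (at p) v \<noteq> 0) \<and> K \<inter> W = {x \<in> W. \<phi> x \<le> 0})"

definition radial_body :: "('a::euclidean_space \<Rightarrow> real) \<Rightarrow> 'a set" where
  "radial_body \<rho> = {s *\<^sub>R u | s u. norm u = 1 \<and> 0 \<le> s \<and> s \<le> \<rho> u}"

definition center_of_mass :: "'a::euclidean_space set \<Rightarrow> 'a" where
  "center_of_mass K = (\<integral>x. x \<partial>lebesgue_on K) /\<^sub>R measure lebesgue K"

(* Differential calculus on the unit sphere.  A function g on the sphere is represented by
   its 0-homogeneous extension x \<mapsto> g (x / norm x) (recall sgn x = x / norm x).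
   Restricted to the affine tangent plane at u, this is g read in the chart given by central
   projection.  The extension is constant along rays, so its differential at u vanishes iff
   the differential of g on the tangent space does. *)
definition sphere_ext :: "('a::euclidean_space \<Rightarrow> real) \<Rightarrow> 'a \<Rightarrow> real" where
  "sphere_ext g = (\<lambda>x. g (sgn x))"

definition critical_points :: "('a::euclidean_space \<Rightarrow> real) \<Rightarrow> 'a set" where
  "critical_points g = {u \<in> sphere 0 1. (sphere_ext g has_derivative (\<lambda>h. 0)) (at u)}"

(* At a critical point u and for tangent v, w this is the intrinsic Hessian of g. *)
definition sphere_hessian :: "('a::euclidean_space \<Rightarrow> real) \<Rightarrow> 'a \<Rightarrow> 'a \<Rightarrow> 'a \<Rightarrow> real" where
  "sphere_hessian g u v w =
     frechet_derivative (\<lambda>x. frechet_derivative (sphere_ext g) (at x) v) (at u) w"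

definition morse_on_sphere :: "('a::euclidean_space \<Rightarrow> real) \<Rightarrow> bool" where
  "morse_on_sphere g \<longleftrightarrow>
     Ck_on 2 (sphere_ext g) (- {0}) \<and>
     (\<forall>u\<in>critical_points g. \<forall>v. v \<bullet> u = 0 \<and> v \<noteq> 0 \<longrightarrow>
        (\<exists>w. w \<bullet> u = 0 \<and> sphere_hessian g u v w \<noteq> 0))"

definition stable_equilibria :: "('a::euclidean_space \<Rightarrow> real) \<Rightarrow> 'a set" where
  "stable_equilibria \<rho> =
     {u \<in> critical_points \<rho>. \<forall>\<^sub>F v in at u within sphere 0 1. \<rho> u \<le> \<rho> v}"

definition unstable_equilibria :: "('a::euclidean_space \<Rightarrow> real) \<Rightarrow> 'a set" where
  "unstable_equilibria \<rho> =
     {u \<in> critical_points \<rho>. \<forall>\<^sub>F v in at u within sphere 0 1. \<rho> v \<le> \<rho> u}"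

definition saddles :: "('a::euclidean_space \<Rightarrow> real) \<Rightarrow> 'a set" where
  "saddles \<rho> = critical_points \<rho> - (stable_equilibria \<rho> \<union> unstable_equilibria \<rho>)"

(* The sets counted below are finite for Morse functions, so card is the actual number. *)
definition num_equilibria :: "('a::euclidean_space \<Rightarrow> real) \<Rightarrow> nat" where
  "num_equilibria \<rho> = card (critical_points \<rho>)"

definition num_stable :: "('a::euclidean_space \<Rightarrow> real) \<Rightarrow> nat" where
  "num_stable \<rho> = card (stable_equilibria \<rho>)"

definition num_unstable :: "('a::euclidean_space \<Rightarrow> real) \<Rightarrow> nat" where
  "num_unstable \<rho> = card (unstable_equilibria \<rho>)"

definition num_saddles :: "('a::euclidean_space \<Rightarrow> real) \<Rightarrow> nat" where
  "num_saddles \<rho> = card (saddles \<rho>)"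

(* The one-sided derivative is meant at endpoints of I that belong to I. *)
definition radial_flow ::
  "(real \<Rightarrow> real) \<Rightarrow> real set \<Rightarrow> ('a::euclidean_space \<Rightarrow> real \<Rightarrow> real) \<Rightarrow> bool" where
  "radial_flow f I r \<longleftrightarrow>
     (\<forall>u\<in>sphere 0 1. \<forall>t\<in>I. 0 < r u t \<and>
        ((\<lambda>t. r u t) has_real_derivative f (r u t)) (at t within I))"

end

theory Submission
  imports Defs
begin

text \<open>
  Every point of the boundary moves along its ray according to the same autonomous scalar
  equation \<open>x' = f x\<close>, so \<open>r u t\<close> is a function \<open>\<Phi>\<close> of \<open>r u s\<close> alone, for any two times
  \<open>s\<close> and \<open>t\<close>. This flow map \<open>\<Phi>\<close> is strictly increasing, because two solutions that meet
  coincide (\<open>trajectories_keep_order\<close>), and Lipschitz, because solutions in a compact range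
  separate at most exponentially fast (\<open>trajectories_separation\<close>). Its inverse is the flow map
  from \<open>t\<close> back to \<open>s\<close> and has the same properties.

  Composing a function on the sphere with an increasing bi-Lipschitz map changes neither its
  critical points (\<open>critical_points_Lipschitz_image\<close>) nor the type of any of them, since local
  minima and maxima are defined by order alone. So the sets of stable equilibria, of unstable
  equilibria and of saddles themselves do not depend on time, and a fortiori their cardinalities
  do not. The Lipschitz constant of \<open>\<Phi>\<close> has to be the same for all rays. It is, because a Morse
  function is continuous on the compact sphere: so the initial radius has a minimum and a maximum,
  and the trajectories starting there confine all others to a compact range
  (\<open>radial_flow_Lipschitz\<close>).
\<close>

section \<open>Trajectories of a scalar autonomous equation\<close>

definition trajectory :: "(real \<Rightarrow> real) \<Rightarrow> real set \<Rightarrow> (real \<Rightarrow> real) \<Rightarrow> bool" where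
  "trajectory f I x \<longleftrightarrow> (\<forall>t\<in>I. (x has_real_derivative f (x t)) (at t within I))"

lemma trajectory_continuous_on: "trajectory f I x \<Longrightarrow> continuous_on I x"
  unfolding trajectory_def
  by (meson DERIV_continuous continuous_on_eq_continuous_within)

lemma trajectory_has_derivative_interior:
  assumes "trajectory f I x" and "{a..b} \<subseteq> I" and "a < t" and "t < b"
  shows "(x has_real_derivative f (x t)) (at t)"
proof -
  have t: "t \<in> interior I"
    using assms(3,4) interior_mono[OF assms(2)] by auto
  then have "t \<in> I"
    using interior_subset by blast
  then show ?thesis
    using assms(1) unfolding trajectory_def at_within_interior[OF t, symmetric] by blast
qed

lemma C1_Lipschitz_on_interval:
  fixes f :: "real \<Rightarrow> real"
  assumes "f C1_differentiable_on UNIV"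
  obtains L where "0 \<le> L"
    and "\<And>p q. \<lbrakk>p \<in> {m..M}; q \<in> {m..M}\<rbrakk> \<Longrightarrow> \<bar>f p - f q\<bar> \<le> L * \<bar>p - q\<bar>"
proof -
  obtain D where D: "\<And>x. (f has_vector_derivative D x) (at x)" and contD: "continuous_on UNIV D"
    using assms by (auto simp: C1_differentiable_on_def)
  have "bounded (D ` {m..M})"
    by (intro compact_imp_bounded compact_continuous_image continuous_on_subset[OF contD]) auto
  then obtain B where B: "\<And>x. x \<in> {m..M} \<Longrightarrow> norm (D x) \<le> B"
    unfolding bounded_iff by blast
  have "\<bar>f p - f q\<bar> \<le> max B 0 * \<bar>p - q\<bar>" if "p \<in> {m..M}" "q \<in> {m..M}" for p q
  proof -
    have "norm (f p - f q) \<le> max B 0 * norm (p - q)"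
    proof (rule field_differentiable_bound[of "{m..M}" f D])
      show "(f has_field_derivative D z) (at z within {m..M})" for z
        using D[of z] by (simp add: has_real_derivative_iff_has_vector_derivative
            has_vector_derivative_at_within)
      show "norm (D z) \<le> max B 0" if "z \<in> {m..M}" for z
        using B[OF that] by simp
    qed (use that in auto)
    then show ?thesis by simp
  qed
  then show thesis
    using that[of "max B 0"] by simp
qed

text \<open>
  The two-sided form of Gronwall's inequality: \<open>D\<close> times a growing exponential is nondecreasing,
  and \<open>D\<close> times a decaying one is nonincreasing.
\<close>
lemma Gronwall_two_sided:
  fixes D :: "real \<Rightarrow> real"
  assumes "a \<le> b" and cont: "continuous_on {a..b} D"
    and deriv: "\<And>s. \<lbrakk>a < s; s < b\<rbrakk> \<Longrightarrow> (D has_real_derivative D' s) (at s)"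
    and bound: "\<And>s. \<lbrakk>a < s; s < b\<rbrakk> \<Longrightarrow> \<bar>D' s\<bar> \<le> K * D s"
  shows "D b \<le> exp (K * (b - a)) * D a" and "D a \<le> exp (K * (b - a)) * D b"
proof -
  have "D b * exp (- K * b) \<le> D a * exp (- K * a)"
  proof (rule DERIV_nonpos_imp_decreasing_open[OF \<open>a \<le> b\<close>])
    fix s assume s: "a < s" "s < b"
    have "((\<lambda>s. D s * exp (- K * s)) has_real_derivative (D' s - K * D s) * exp (- K * s)) (at s)"
      by (auto intro!: derivative_eq_intros deriv[OF s] simp: algebra_simps)
    moreover have "(D' s - K * D s) * exp (- K * s) \<le> 0"
      using bound[OF s] by (intro mult_nonpos_nonneg) auto
    ultimately show "\<exists>y. ((\<lambda>s. D s * exp (- K * s)) has_real_derivative y) (at s) \<and> y \<le> 0"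
      by blast
  qed (intro continuous_intros cont)
  then have "D b * exp (- K * b) * exp (K * b) \<le> D a * exp (- K * a) * exp (K * b)"
    by (rule mult_right_mono) simp
  then show "D b \<le> exp (K * (b - a)) * D a"
    by (simp add: mult.assoc flip: exp_add) (simp add: algebra_simps)
  have "D a * exp (K * a) \<le> D b * exp (K * b)"
  proof (rule DERIV_nonneg_imp_increasing_open[OF \<open>a \<le> b\<close>])
    fix s assume s: "a < s" "s < b"
    have "((\<lambda>s. D s * exp (K * s)) has_real_derivative (D' s + K * D s) * exp (K * s)) (at s)"
      by (auto intro!: derivative_eq_intros deriv[OF s] simp: algebra_simps)
    moreover have "0 \<le> (D' s + K * D s) * exp (K * s)"
      using bound[OF s] by (intro mult_nonneg_nonneg) auto
    ultimately show "\<exists>y. ((\<lambda>s. D s * exp (K * s)) has_real_derivative y) (at s) \<and> 0 \<le> y"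
      by blast
  qed (intro continuous_intros cont)
  then have "D a * exp (K * a) * exp (- K * a) \<le> D b * exp (K * b) * exp (- K * a)"
    by (rule mult_right_mono) simp
  then show "D a \<le> exp (K * (b - a)) * D b"
    by (simp add: mult.assoc flip: exp_add) (simp add: algebra_simps)
qed

text \<open>
  Gronwall's inequality is applied to the squared distance of the two solutions, which is
  differentiable even where they meet. Since it controls the distance in both directions of time,
  the roles of \<open>a\<close> and \<open>b\<close> are interchangeable.
\<close>
lemma trajectories_separation:
  fixes x y :: "real \<Rightarrow> real"
  assumes x: "trajectory f I x" and y: "trajectory f I y"
    and I: "is_interval I" "a \<in> I" "b \<in> I" and "0 \<le> L"
    and range: "\<And>s. s \<in> closed_segment a b \<Longrightarrow> x s \<in> {m..M} \<and> y s \<in> {m..M}"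
    and Lipschitz: "\<And>p q. \<lbrakk>p \<in> {m..M}; q \<in> {m..M}\<rbrakk> \<Longrightarrow> \<bar>f p - f q\<bar> \<le> L * \<bar>p - q\<bar>"
  shows "\<bar>x b - y b\<bar> \<le> exp (L * \<bar>b - a\<bar>) * \<bar>x a - y a\<bar>"
proof -
  define D where "D s = (x s - y s)\<^sup>2" for s
  have two_sided: "D d \<le> exp (2 * L * (d - c)) * D c \<and> D c \<le> exp (2 * L * (d - c)) * D d"
    if cd: "c \<le> d" "c \<in> I" "d \<in> I" and seg: "{c..d} = closed_segment a b" for c d
  proof -
    have sub: "{c..d} \<subseteq> I"
      using I(1) cd by (meson atLeastAtMost_iff is_interval_1 subsetI)
    have "continuous_on {c..d} D"
      unfolding D_def
      by (intro continuous_intros continuous_on_subset[OF trajectory_continuous_on sub])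
        (fact x y)+
    moreover have "(D has_real_derivative 2 * (x s - y s) * (f (x s) - f (y s))) (at s)"
      if "c < s" "s < d" for s
    proof -
      note [derivative_intros] = trajectory_has_derivative_interior[OF x sub that]
        trajectory_has_derivative_interior[OF y sub that]
      show ?thesis
        unfolding D_def by (auto intro!: derivative_eq_intros)
    qed
    moreover have "\<bar>2 * (x s - y s) * (f (x s) - f (y s))\<bar> \<le> 2 * L * D s"
      if "c < s" "s < d" for s
    proof -
      have "s \<in> closed_segment a b"
        using that by (auto simp flip: seg)
      then have "\<bar>f (x s) - f (y s)\<bar> \<le> L * \<bar>x s - y s\<bar>"
        using range Lipschitz by blast
      then have "\<bar>x s - y s\<bar> * \<bar>f (x s) - f (y s)\<bar> \<le> \<bar>x s - y s\<bar> * (L * \<bar>x s - y s\<bar>)"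
        by (intro mult_left_mono) auto
      also have "\<dots> = L * \<bar>x s - y s\<bar>\<^sup>2"
        by (simp add: power2_eq_square)
      finally show ?thesis
        by (simp add: D_def abs_mult del: right_diff_distrib_numeral)
    qed
    ultimately show ?thesis
      using Gronwall_two_sided[OF cd(1), of D "\<lambda>s. 2 * (x s - y s) * (f (x s) - f (y s))" "2 * L"]
      by blast
  qed
  have "D b \<le> exp (2 * L * \<bar>b - a\<bar>) * D a"
  proof (cases "a \<le> b")
    case True
    then show ?thesis
      using two_sided[of a b] I by (simp add: closed_segment_eq_real_ivl)
  next
    case False
    then show ?thesis
      using two_sided[of b a] I by (simp add: closed_segment_eq_real_ivl)
  qed
  also have "\<dots> = (exp (L * \<bar>b - a\<bar>) * \<bar>x a - y a\<bar>)\<^sup>2"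
    by (simp add: D_def power_mult_distrib mult.assoc flip: exp_double)
  finally have "\<bar>x b - y b\<bar>\<^sup>2 \<le> (exp (L * \<bar>b - a\<bar>) * \<bar>x a - y a\<bar>)\<^sup>2"
    by (simp add: D_def)
  then show ?thesis
    by (rule power2_le_imp_le) auto
qed

lemma trajectories_agree:
  fixes x y :: "real \<Rightarrow> real"
  assumes f: "f C1_differentiable_on UNIV" and x: "trajectory f I x" and y: "trajectory f I y"
    and I: "is_interval I" "a \<in> I" "b \<in> I" and eq: "x a = y a"
  shows "x b = y b"
proof -
  have seg: "closed_segment a b \<subseteq> I"
    using I closed_segment_subset is_interval_convex by blast
  have "compact (z ` closed_segment a b)" if "trajectory f I z" for z
    by (intro compact_continuous_image compact_segment
        continuous_on_subset[OF trajectory_continuous_on[OF that] seg])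
  then have "bounded (x ` closed_segment a b \<union> y ` closed_segment a b)"
    using x y by (simp add: compact_imp_bounded)
  then obtain B where B: "\<And>s. s \<in> closed_segment a b \<Longrightarrow> \<bar>x s\<bar> \<le> B \<and> \<bar>y s\<bar> \<le> B"
    unfolding bounded_iff by auto
  obtain L where L: "0 \<le> L"
      "\<And>p q. \<lbrakk>p \<in> {- B..B}; q \<in> {- B..B}\<rbrakk> \<Longrightarrow> \<bar>f p - f q\<bar> \<le> L * \<bar>p - q\<bar>"
    using C1_Lipschitz_on_interval[OF f, of "- B" B] by metis
  have "\<bar>x b - y b\<bar> \<le> exp (L * \<bar>b - a\<bar>) * \<bar>x a - y a\<bar>"
  proof (rule trajectories_separation[OF x y I L(1) _ L(2)])
    show "x s \<in> {- B..B} \<and> y s \<in> {- B..B}" if "s \<in> closed_segment a b" for s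
      using B[OF that] by (auto simp: abs_le_iff)
  qed
  then show ?thesis
    using eq by simp
qed

text \<open>
  To overtake one another, two solutions would first have to meet, and then they would be equal
  for all times.
\<close>
lemma trajectories_keep_order:
  fixes x y :: "real \<Rightarrow> real"
  assumes f: "f C1_differentiable_on UNIV" and x: "trajectory f I x" and y: "trajectory f I y"
    and I: "is_interval I" "a \<in> I" "b \<in> I" and le: "x a \<le> y a"
  shows "x b \<le> y b"
proof (rule ccontr)
  assume "\<not> x b \<le> y b"
  have "is_interval ((\<lambda>s. y s - x s) ` I)"
    using I(1) trajectory_continuous_on[OF x] trajectory_continuous_on[OF y]
    unfolding is_interval_connected_1
    by (intro connected_continuous_image continuous_intros) auto
  moreover have "y b - x b \<le> 0" "0 \<le> y a - x a"
    using le \<open>\<not> x b \<le> y b\<close> by auto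
  ultimately have "0 \<in> (\<lambda>s. y s - x s) ` I"
    using I(2,3) unfolding is_interval_1 by blast
  then obtain s where "s \<in> I" "x s = y s"
    by auto
  then show False
    using trajectories_agree[OF f x y I(1) _ I(3)] \<open>\<not> x b \<le> y b\<close> by force
qed

section \<open>Critical points on the sphere\<close>

text \<open>
  The differential vanishes iff the increments of the function are of smaller order than the
  displacement, and a Lipschitz map enlarges these increments at most by a constant factor.
\<close>
lemma critical_points_Lipschitz_image:
  fixes g h :: "'a::euclidean_space \<Rightarrow> real"
  assumes u: "u \<in> critical_points g"
    and Lipschitz: "\<And>v. v \<in> sphere 0 1 \<Longrightarrow> \<bar>h v - h u\<bar> \<le> C * \<bar>g v - g u\<bar>"
  shows "u \<in> critical_points h"
proof -
  have norm_u: "norm u = 1" and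
    deriv: "(sphere_ext g has_derivative (\<lambda>_. 0)) (at u)"
    using u by (auto simp: critical_points_def)
  have "((\<lambda>y. norm (sphere_ext g y - sphere_ext g u - 0) / norm (y - u)) \<longlongrightarrow> 0) (at u)"
    using deriv unfolding has_derivative_iff_norm by blast
  then have "((\<lambda>y. C * (\<bar>sphere_ext g y - sphere_ext g u\<bar> / norm (y - u))) \<longlongrightarrow> 0) (at u)"
    by (intro tendsto_mult_right_zero) simp
  moreover have "\<forall>\<^sub>F y in at u. norm (\<bar>sphere_ext h y - sphere_ext h u\<bar> / norm (y - u))
      \<le> C * (\<bar>sphere_ext g y - sphere_ext g u\<bar> / norm (y - u))"
  proof -
    have "u \<noteq> 0"
      using norm_u by auto
    then have "\<forall>\<^sub>F y in at u. y \<noteq> 0"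
      by (intro tendsto_imp_eventually_ne[OF tendsto_ident_at])
    then show ?thesis
    proof eventually_elim
      case (elim y)
      then have "\<bar>h (sgn y) - h (sgn u)\<bar> \<le> C * \<bar>g (sgn y) - g (sgn u)\<bar>"
        using Lipschitz[of "sgn y"] norm_u by (simp add: norm_sgn sgn_div_norm)
      then have "\<bar>h (sgn y) - h (sgn u)\<bar> / norm (y - u)
          \<le> C * \<bar>g (sgn y) - g (sgn u)\<bar> / norm (y - u)"
        by (rule divide_right_mono) simp
      then show ?case
        by (simp add: sphere_ext_def)
    qed
  qed
  ultimately have "((\<lambda>y. \<bar>sphere_ext h y - sphere_ext h u\<bar> / norm (y - u)) \<longlongrightarrow> 0) (at u)"
    by (rule Lim_null_comparison[rotated])
  then show ?thesis
    using norm_u by (simp add: critical_points_def has_derivative_iff_norm)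
qed

lemma morse_on_sphere_continuous:
  fixes g :: "'a::euclidean_space \<Rightarrow> real"
  assumes "morse_on_sphere g"
  shows "continuous_on (sphere 0 1) g"
proof -
  have "\<forall>x\<in>- {0}. sphere_ext g differentiable (at x)"
    using assms by (simp add: morse_on_sphere_def numeral_2_eq_2)
  then have "isCont (sphere_ext g) x" if "x \<in> sphere 0 1" for x
    using that by (intro differentiable_imp_continuous_within) auto
  then have "continuous_on (sphere 0 1) (sphere_ext g)"
    by (simp add: continuous_at_imp_continuous_on)
  then show ?thesis
    by (rule continuous_on_eq) (simp add: sphere_ext_def sgn_div_norm)
qed

section \<open>Invariance of the equilibria under the radial flow\<close>

text \<open>
  Order preservation keeps the rays of least and of greatest radius extremal at all times, so between \<open>a\<close>
  and \<open>b\<close> all radii stay in the compact interval bounded by the least value on the former and the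
  greatest value on the latter. A Lipschitz constant of \<open>f\<close> there serves for all rays at once.
\<close>
lemma radial_flow_Lipschitz:
  fixes r :: "'a::euclidean_space \<Rightarrow> real \<Rightarrow> real"
  assumes f: "f C1_differentiable_on UNIV" and I: "is_interval I" "c \<in> I" "a \<in> I" "b \<in> I"
    and flow: "\<And>v. v \<in> sphere 0 1 \<Longrightarrow> trajectory f I (r v)"
    and cont: "continuous_on (sphere 0 1) (\<lambda>v. r v c)"
  obtains C where "\<And>u v. \<lbrakk>u \<in> sphere 0 1; v \<in> sphere 0 1\<rbrakk>
      \<Longrightarrow> \<bar>r v b - r u b\<bar> \<le> C * \<bar>r v a - r u a\<bar>"
proof -
  have seg: "closed_segment a b \<subseteq> I"
    using I closed_segment_subset is_interval_convex by blast
  have "sphere (0::'a) 1 \<noteq> {}"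
    by simp
  then obtain lo hi where lo: "lo \<in> sphere 0 1" "\<And>v. v \<in> sphere 0 1 \<Longrightarrow> r lo c \<le> r v c"
    and hi: "hi \<in> sphere 0 1" "\<And>v. v \<in> sphere 0 1 \<Longrightarrow> r v c \<le> r hi c"
    using continuous_attains_inf[OF compact_sphere _ cont]
      continuous_attains_sup[OF compact_sphere _ cont] by metis
  have between: "r lo s \<le> r v s \<and> r v s \<le> r hi s" if "v \<in> sphere 0 1" "s \<in> I" for v s
    using trajectories_keep_order[OF f flow flow I(1,2) that(2)] lo hi that(1) by blast
  have cont_seg: "continuous_on (closed_segment a b) (r v)" if "v \<in> sphere 0 1" for v
    by (rule continuous_on_subset[OF trajectory_continuous_on[OF flow[OF that]] seg])
  obtain s1 where s1: "\<And>s. s \<in> closed_segment a b \<Longrightarrow> r lo s1 \<le> r lo s"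
    using continuous_attains_inf[OF compact_segment _ cont_seg[OF lo(1)]] by auto
  obtain s2 where s2: "\<And>s. s \<in> closed_segment a b \<Longrightarrow> r hi s \<le> r hi s2"
    using continuous_attains_sup[OF compact_segment _ cont_seg[OF hi(1)]] by auto
  have range: "r v s \<in> {r lo s1..r hi s2}"
    if "v \<in> sphere 0 1" "s \<in> closed_segment a b" for v s
    using between[OF that(1), of s] s1[OF that(2)] s2[OF that(2)] that(2) seg by auto
  obtain L where L: "0 \<le> L" "\<And>p q. \<lbrakk>p \<in> {r lo s1..r hi s2}; q \<in> {r lo s1..r hi s2}\<rbrakk>
      \<Longrightarrow> \<bar>f p - f q\<bar> \<le> L * \<bar>p - q\<bar>"
    using C1_Lipschitz_on_interval[OF f, of "r lo s1" "r hi s2"] by metis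
  show thesis
  proof (rule that[of "exp (L * \<bar>b - a\<bar>)"])
    fix u v :: 'a assume uv: "u \<in> sphere 0 1" "v \<in> sphere 0 1"
    show "\<bar>r v b - r u b\<bar> \<le> exp (L * \<bar>b - a\<bar>) * \<bar>r v a - r u a\<bar>"
      by (rule trajectories_separation[OF flow[OF uv(2)] flow[OF uv(1)] I(1,3,4) L(1) _ L(2)])
        (use range uv in blast)+
  qed
qed

lemma equilibria_order_invariant:
  fixes g h :: "'a::euclidean_space \<Rightarrow> real"
  assumes crit: "critical_points g = critical_points h"
    and order: "\<And>u v. \<lbrakk>u \<in> sphere 0 1; v \<in> sphere 0 1\<rbrakk> \<Longrightarrow> g u \<le> g v \<longleftrightarrow> h u \<le> h v"
  shows "stable_equilibria g = stable_equilibria h"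
    and "unstable_equilibria g = unstable_equilibria h"
    and "saddles g = saddles h"
proof -
  have "(\<forall>\<^sub>F v in at u within sphere 0 1. g u \<le> g v) \<longleftrightarrow>
        (\<forall>\<^sub>F v in at u within sphere 0 1. h u \<le> h v)"
       "(\<forall>\<^sub>F v in at u within sphere 0 1. g v \<le> g u) \<longleftrightarrow>
        (\<forall>\<^sub>F v in at u within sphere 0 1. h v \<le> h u)" if "u \<in> critical_points h" for u
  proof -
    have "u \<in> sphere 0 1"
      using that by (auto simp: critical_points_def)
    then show
      "(\<forall>\<^sub>F v in at u within sphere 0 1. g u \<le> g v) \<longleftrightarrow>
       (\<forall>\<^sub>F v in at u within sphere 0 1. h u \<le> h v)"
      "(\<forall>\<^sub>F v in at u within sphere 0 1. g v \<le> g u) \<longleftrightarrow>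
       (\<forall>\<^sub>F v in at u within sphere 0 1. h v \<le> h u)"
      using order unfolding eventually_at_filter
      by (auto intro!: arg_cong2[where f = eventually] ext)
  qed
  then show stable: "stable_equilibria g = stable_equilibria h"
    and unstable: "unstable_equilibria g = unstable_equilibria h"
    using crit by (auto simp: stable_equilibria_def unstable_equilibria_def)
  show "saddles g = saddles h"
    by (simp add: saddles_def crit stable unstable)
qed

theorem corollary1:
  fixes f :: "real \<Rightarrow> real"
    and r :: "real ^ 'n \<Rightarrow> real \<Rightarrow> real"
    and I :: "real set"
  assumes dim: "CARD('n) = 2 \<or> CARD('n) = 3"
    and f: "f C1_differentiable_on UNIV"
    and I: "is_interval I" "0 \<in> I"
    and flow: "radial_flow f I r"
    and smooth: "Ck_smooth_body 3 (radial_body (\<lambda>u. r u 0))"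
    and convex: "convex (radial_body (\<lambda>u. r u 0))"
    and morse: "morse_on_sphere (\<lambda>u. r u 0)"
    and com: "\<And>t. t \<in> I \<Longrightarrow> center_of_mass (radial_body (\<lambda>u. r u t)) = 0"
  shows "(\<lambda>t. num_equilibria (\<lambda>u. r u t)) constant_on I \<and>
         (\<lambda>t. num_stable (\<lambda>u. r u t)) constant_on I \<and>
         (\<lambda>t. num_unstable (\<lambda>u. r u t)) constant_on I \<and>
         (\<lambda>t. num_saddles (\<lambda>u. r u t)) constant_on I"
proof -
  have traj: "trajectory f I (r v)" if "v \<in> sphere 0 1" for v
    using flow that by (simp add: radial_flow_def trajectory_def)
  have cont: "continuous_on (sphere 0 1) (\<lambda>v. r v 0)"
    using morse by (rule morse_on_sphere_continuous)
  have "critical_points (\<lambda>u. r u a) \<subseteq> critical_points (\<lambda>u. r u b)"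
    if ab: "a \<in> I" "b \<in> I" for a b
  proof (rule radial_flow_Lipschitz[OF f I ab traj cont])
    fix C
    assume C: "\<And>u v. \<lbrakk>u \<in> sphere 0 1; v \<in> sphere 0 1\<rbrakk>
      \<Longrightarrow> \<bar>r v b - r u b\<bar> \<le> C * \<bar>r v a - r u a\<bar>"
    show ?thesis
    proof
      fix u assume u: "u \<in> critical_points (\<lambda>u. r u a)"
      then have "u \<in> sphere 0 1"
        by (simp add: critical_points_def)
      then show "u \<in> critical_points (\<lambda>u. r u b)"
        by (intro critical_points_Lipschitz_image[OF u, of "\<lambda>u. r u b" C] C)
    qed
  qed
  then have crit: "critical_points (\<lambda>u. r u t) = critical_points (\<lambda>u. r u 0)" if "t \<in> I" for t
    using I(2) that by (simp add: subset_antisym)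
  have order: "r u t \<le> r v t \<longleftrightarrow> r u 0 \<le> r v 0"
    if "t \<in> I" "u \<in> sphere 0 1" "v \<in> sphere 0 1" for t u v
    using trajectories_keep_order[OF f traj[OF that(2)] traj[OF that(3)] I(1)] I(2) that(1) by blast
  have "num_equilibria (\<lambda>u. r u t) = num_equilibria (\<lambda>u. r u 0) \<and>
        num_stable (\<lambda>u. r u t) = num_stable (\<lambda>u. r u 0) \<and>
        num_unstable (\<lambda>u. r u t) = num_unstable (\<lambda>u. r u 0) \<and>
        num_saddles (\<lambda>u. r u t) = num_saddles (\<lambda>u. r u 0)" if "t \<in> I" for t
    unfolding num_equilibria_def num_stable_def num_unstable_def num_saddles_def
    using crit[OF that] equilibria_order_invariant[OF crit[OF that] order[OF that]] by metis
  then show ?thesis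
    unfolding constant_on_def by blast
qed

end
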